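(* Let $\eta\ge0$, $\mathfrak L>0$, $f\in\mathcal G(\eta,\mathfrak L)$, $\varepsilon>0$ and $\delta\in(0,1)$ be such that $\delta<2\exp\big(-\mathfrak c(1+q_+)(1-q_+)^{-(1-q_+)/2}\big)$ if $\eta=0$ and $\delta<\mathrm e^{-2}$ if $\eta>0$. Then, for $t\ge\Psi(\varepsilon,\delta)$, $$\mathbb P^\mu\Big(\Big|\frac1t\int_0^tf(X_s)\,ds-\mu(f)\Big|\le\varepsilon\Big)\ge1-\delta.$$ Moreover, for any increasing sequence $(t_n)_{n\in\mathbb N}\subset\mathbb R_+$ with $\inf_n(t_n-t_{n-1})>0$ and any $\delta_0>0$, $$\lim_{n\to\infty}\sqrt{t_n}\,(\log t_n)^{-(\varsigma(\eta,q,q')+\delta_0)}\Big|\frac1{t_n}\int_0^{t_n}f(X_s)\,ds-\mu(f)\Big|=0,\quad\mathbb P^\mu\text{-a.s.}$$ If $f$ is bounded, then even, for any $\tilde q\in(q_+,1)$, $$\lim_{t\to\infty}\sqrt t\,(\log t)^{-\frac1{1-\tilde q}}\Big|\frac1t\int_0^tf(X_s)\,ds-\mu(f)\Big|=0,\quad\mathbb P^\mu\text{-a.s.}$$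
   Context: Setting. $\|\cdot\|$ is the Euclidean norm. $X=(X_t)_{t\ge0}$ with the family $(\mathbb P^x)_{x\in\mathbb R^d}$ is the Markovian weak solution, with continuous paths, of $dX_t=b(X_t)\,dt+\sigma(X_t)\,dW_t$ on $\mathbb R^d$, with $X_0=x$ under $\mathbb P^x$; $\mathbb P^\nu=\int\mathbb P^x\,\nu(dx)$. Here $b:\mathbb R^d\to\mathbb R^d$ is locally Lipschitz with $\|b(x)\|\le \mathrm{const}\,(1+\|x\|^{q'})$ for some $q'\ge 0$; $\sigma:\mathbb R^d\to\mathbb R^{d\times d}$ is uniformly continuous, bounded and locally Lipschitz; $a:=\sigma\sigma^\top$ is uniformly elliptic, i.e. for some $\lambda>0$, $\langle a(x)\xi,\xi\rangle\ge\lambda\|\xi\|^2$ for all $x,\xi$. Drift condition: there are $q\in[-1,1)$, $M_0\ge0$, $\mathfrak r>0$ with $\langle b(x),x/\|x\|\rangle\le-\mathfrak r\|x\|^{-q}$ whenever $\|x\|\ge M_0$. $q_+=\max\{q,0\}$. Then $X$ has a unique invariant distribution $\mu$; $\mu(f)=\int f\,d\mu$. Function classes (Borel functions): $\mathcal G(\eta,\mathfrak L)=\{f:\mathbb R^d\to\mathbb R:\ |f(x)|\le\mathfrak L(1+\|x\|^\eta)\ \forall x\}$, $\mathcal F(\eta,\mathfrak L)=\{\tilde f-\mu(\tilde f):\tilde f\in\mathcal G(\eta,\mathfrak L)\}$. Also $\mathbb G_t(f)=t^{-1/2}\int_0^tf(X_s)\,ds$. Constants. $\lambda_+$ is the smallest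 constant with $\langle a(x)x/\|x\|,x/\|x\|\rangle\le\lambda_+$ for all $x\ne0$; $\iota>0$ is fixed with $\mathfrak r>\iota\lambda_+(1-q_+)/2$; $\iota'=\iota^{(1+q_+)/(1-q_+)}(1+q_+)(\mathfrak r-\lambda_+\iota(1-q_+)/2)$; $\iota''\in(0,\iota')$ is fixed; $$c(q,\iota'')=\tfrac12\Big(\tfrac{1+q_+}{1-q_+}\Big)^{1/(1-q_+)}\Big(\tfrac{(1-q_+)\iota''}{1+q_+}\Big)^{(1+q_+)/(2(1-q_+))}.$$ $\mathfrak c>0$ is a constant (known to exist from the literature) such that for all $f\in\mathcal F(0,\mathfrak L)$ and all $u,t>0$ with $\mathfrak c(1+q_+)(1-q_+)^{-(1-q_+)/2}\le u<(c(q,\iota'')\lfloor t\rfloor/\sqrt t)^{1-q_+}$ one has $$\mathbb P^\mu\Big(|\mathbb G_t(f)|>2\mathfrak L\big(c(q,\iota'')^{-1}u^{1/(1-q_+)}+t^{-1/2}\big)\Big)\le2\mathrm e^{-u}.$$ $\mathfrak W$ is a constant, depending on $q,\eta,b,\sigma$ only, such that $\|\mathbb G_t(f)\|_{L^p(\mathbb P^\mu)}\le\mathfrak L\mathfrak W p^{\frac12+\frac{\eta+q'+q+1}{1-q_+}}$ for all $p\ge2$, $t>0$, $f\in\mathcal F(\eta,\mathfrak L)$, and consequently $\mathbb P^\mu(|\mathbb G_t(f)|>\mathrm e\mathfrak L\mathfrak W u^{\frac12+\frac{\eta+q'+q+1}{1-q_+}})\le\mathrm e^{-u}$ for $u\ge2$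 (such a constant exists). Rate function: $\varsigma(\eta,q,q')=\frac1{1-q_+}$ if $\eta=0$, and $\varsigma(\eta,q,q')=\frac12+\frac{\eta+q'+q+1}{1-q_+}$ if $\eta>0$. Sample length function: if $\eta=0$, $\Psi(\varepsilon,\delta)=\Big(\dfrac{c(q,\iota'')^{-1}(\log(2/\delta))^{1/(1-q_+)}+1}{1\wedge\varepsilon/(2\mathfrak L)}\Big)^2$; if $\eta>0$, $\Psi(\varepsilon,\delta)=\Big(\dfrac{\mathrm e\mathfrak L\mathfrak W(\log(1/\delta))^{\frac12+\frac{\eta+q'+q+1}{1-q_+}}}{\varepsilon}\Big)^2$. *)

theory Defs
  imports "HOL-Probability.Probability"
begin

section \<open>Brownian motion, stochastic integrals and weak solutions\<close>

text \<open>Time is \<open>[0,\<infinity>)\<close>; values of processes and filtrations at negative times are never used.\<close>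

definition is_filtration :: "'w measure \<Rightarrow> (real \<Rightarrow> 'w measure) \<Rightarrow> bool" where
  "is_filtration M F \<longleftrightarrow>
     (\<forall>t\<ge>0. subalgebra M (F t)) \<and> (\<forall>s t. 0 \<le> s \<and> s \<le> t \<longrightarrow> subalgebra (F t) (F s))"

definition adapted :: "(real \<Rightarrow> 'w measure) \<Rightarrow> (real \<Rightarrow> 'w \<Rightarrow> 'b::topological_space) \<Rightarrow> bool" where
  "adapted F Y \<longleftrightarrow> (\<forall>t\<ge>0. Y t \<in> borel_measurable (F t))"

text \<open>The increment \<open>W\<^sub>t - W\<^sub>s\<close> has the distribution \<open>N(0, (t - s) I)\<close>; \<^const>\<open>normal_density\<close> takes the
  standard deviation. Only almost all paths are required to be continuous, so that the raw
  (uncompleted) filtration is admissible.\<close>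

definition brownian_motion ::
  "'w measure \<Rightarrow> (real \<Rightarrow> 'w measure) \<Rightarrow> (real \<Rightarrow> 'w \<Rightarrow> real ^ 'n) \<Rightarrow> bool" where
  "brownian_motion M F W \<longleftrightarrow>
     adapted F W \<and>
     (AE w in M. W 0 w = 0) \<and>
     (AE w in M. continuous_on {0..} (\<lambda>t. W t w)) \<and>
     (\<forall>s t. 0 \<le> s \<and> s < t \<longrightarrow>
        prob_space.indep_set M (sets (F s))
          {(\<lambda>w. W t w - W s w) -` B \<inter> space M | B. B \<in> sets borel} \<and>
        distributed M lborel (\<lambda>w. W t w - W s w)
          (\<lambda>x. ennreal (\<Prod>i\<in>UNIV. normal_density 0 (sqrt (t - s)) (x $ i))))"

definition progressively_measurable ::
  "(real \<Rightarrow> 'w measure) \<Rightarrow> (real \<Rightarrow> 'w \<Rightarrow> 'b::topological_space) \<Rightarrow> bool" where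
  "progressively_measurable F H \<longleftrightarrow>
     (\<forall>t\<ge>0. (\<lambda>(r, w). H r w) \<in> borel_measurable (restrict_space borel {0..t} \<Otimes>\<^sub>M F t))"

text \<open>The triple \<open>m\<close>, \<open>s\<close>, \<open>\<xi>\<close> encodes the simple integrand
  \<open>\<Sum>i<m. \<xi>\<^sub>i 1\<^bsub>(s\<^sub>i, s\<^sub>i\<^sub>+\<^sub>1]\<^esub>\<close> with matrix-valued \<open>\<xi>\<^sub>i\<close>.\<close>

definition simple_integrand ::
  "'w measure \<Rightarrow> (real \<Rightarrow> 'w measure) \<Rightarrow> nat \<Rightarrow> (nat \<Rightarrow> real) \<Rightarrow> (nat \<Rightarrow> 'w \<Rightarrow> real ^ 'n ^ 'n) \<Rightarrow> bool"
where
  "simple_integrand M F m s \<xi> \<longleftrightarrow>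
     0 \<le> s 0 \<and> (\<forall>i<m. s i \<le> s (Suc i)) \<and>
     (\<forall>i<m. \<xi> i \<in> borel_measurable (F (s i)) \<and> bounded (\<xi> i ` space M))"

definition simple_process ::
  "nat \<Rightarrow> (nat \<Rightarrow> real) \<Rightarrow> (nat \<Rightarrow> 'w \<Rightarrow> real ^ 'n ^ 'n) \<Rightarrow> real \<Rightarrow> 'w \<Rightarrow> real ^ 'n ^ 'n" where
  "simple_process m s \<xi> r w = (\<Sum>i<m. indicator {s i<..s (Suc i)} r *\<^sub>R \<xi> i w)"

definition simple_integral ::
  "nat \<Rightarrow> (nat \<Rightarrow> real) \<Rightarrow> (nat \<Rightarrow> 'w \<Rightarrow> real ^ 'n ^ 'n) \<Rightarrow> (real \<Rightarrow> 'w \<Rightarrow> real ^ 'n) \<Rightarrow> real \<Rightarrow> 'w \<Rightarrow> real ^ 'n"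
where
  "simple_integral m s \<xi> W t w =
     (\<Sum>i<m. \<xi> i w *v (W (min t (s (Suc i))) w - W (min t (s i)) w))"

text \<open>\<open>J\<close> is (a version of) the Ito integral \<open>\<integral>\<^sub>0\<^sup>t H dW\<close>: there are simple integrands \<open>H\<^sup>n\<close> with
  \<open>\<integral>\<^sub>0\<^sup>t \<parallel>H\<^sup>n - H\<parallel>\<^sup>2 dr \<rightarrow> 0\<close> and \<open>\<integral>\<^sub>0\<^sup>t H\<^sup>n dW \<rightarrow> J\<close>, both in probability.\<close>

definition has_ito_integral ::
  "'w measure \<Rightarrow> (real \<Rightarrow> 'w measure) \<Rightarrow> (real \<Rightarrow> 'w \<Rightarrow> real ^ 'n) \<Rightarrow>
   (real \<Rightarrow> 'w \<Rightarrow> real ^ 'n ^ 'n) \<Rightarrow> real \<Rightarrow> ('w \<Rightarrow> real ^ 'n) \<Rightarrow> bool" where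
  "has_ito_integral M F W H t J \<longleftrightarrow>
     progressively_measurable F H \<and> J \<in> borel_measurable M \<and>
     (\<exists>m s \<xi>. (\<forall>n. simple_integrand M F (m n) (s n) (\<xi> n)) \<and>
        (\<forall>\<epsilon>>0. (\<lambda>n. measure M {w \<in> space M.
             ennreal \<epsilon> < (\<integral>\<^sup>+r\<in>{0..t}.
               ennreal ((norm (simple_process (m n) (s n) (\<xi> n) r w - H r w))\<^sup>2) \<partial>lborel)})
           \<longlonglongrightarrow> 0) \<and>
        (\<forall>\<epsilon>>0. (\<lambda>n. measure M {w \<in> space M.
             \<epsilon> < norm (simple_integral (m n) (s n) (\<xi> n) W t w - J w)}) \<longlonglongrightarrow> 0))"

text \<open>The equation \<open>X\<^sub>t = X\<^sub>0 + \<integral>\<^sub>0\<^sup>t b(X\<^sub>r) dr + \<integral>\<^sub>0\<^sup>t \<sigma>(X\<^sub>r) dW\<^sub>r\<close>, solved for the stochastic integral.\<close>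

definition weak_solution ::
  "(real ^ 'n \<Rightarrow> real ^ 'n) \<Rightarrow> (real ^ 'n \<Rightarrow> real ^ 'n ^ 'n) \<Rightarrow> 'w measure \<Rightarrow> (real \<Rightarrow> 'w measure) \<Rightarrow>
   (real \<Rightarrow> 'w \<Rightarrow> real ^ 'n) \<Rightarrow> (real \<Rightarrow> 'w \<Rightarrow> real ^ 'n) \<Rightarrow> bool" where
  "weak_solution b \<sigma> M F X W \<longleftrightarrow>
     prob_space M \<and> is_filtration M F \<and> brownian_motion M F W \<and> adapted F X \<and>
     (\<forall>w\<in>space M. continuous_on {0..} (\<lambda>t. X t w)) \<and>
     (\<forall>t\<ge>0. has_ito_integral M F W (\<lambda>r w. \<sigma> (X r w)) t
        (\<lambda>w. X t w - X 0 w - (LBINT r:{0..t}. b (X r w))))"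

text \<open>All \<open>P x\<close> live on the measurable space of \<open>N\<close> (whose measure is irrelevant) with one process
  \<open>X\<close>; the driving Brownian motion may depend on \<open>x\<close>.\<close>

definition markovian_weak_solution ::
  "(real ^ 'n \<Rightarrow> real ^ 'n) \<Rightarrow> (real ^ 'n \<Rightarrow> real ^ 'n ^ 'n) \<Rightarrow> 'w measure \<Rightarrow> (real \<Rightarrow> 'w measure) \<Rightarrow>
   (real ^ 'n \<Rightarrow> 'w measure) \<Rightarrow> (real \<Rightarrow> 'w \<Rightarrow> real ^ 'n) \<Rightarrow> bool" where
  "markovian_weak_solution b \<sigma> N F P X \<longleftrightarrow>
     P \<in> borel \<rightarrow>\<^sub>M prob_algebra N \<and>
     (\<forall>x. \<exists>W. weak_solution b \<sigma> (P x) F X W) \<and>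
     (\<forall>x. AE w in P x. X 0 w = x) \<and>
     (\<forall>x s t. \<forall>B\<in>sets borel. 0 \<le> s \<and> 0 \<le> t \<longrightarrow>
        (AE w in P x. real_cond_exp (P x) (F s) (\<lambda>w'. indicator B (X (s + t) w')) w
           = measure (P (X s w)) {w' \<in> space N. X t w' \<in> B}))"

definition law_from :: "(real ^ 'n \<Rightarrow> 'w measure) \<Rightarrow> (real ^ 'n) measure \<Rightarrow> 'w measure" where
  "law_from P \<nu> = bind \<nu> P"

definition invariant_distribution ::
  "(real ^ 'n \<Rightarrow> 'w measure) \<Rightarrow> (real \<Rightarrow> 'w \<Rightarrow> real ^ 'n) \<Rightarrow> (real ^ 'n) measure \<Rightarrow> bool" where
  "invariant_distribution P X \<mu> \<longleftrightarrow>
     prob_space \<mu> \<and> sets \<mu> = sets borel \<and>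
     (\<forall>t\<ge>0. bind \<mu> (\<lambda>x. distr (P x) borel (X t)) = \<mu>)"

section \<open>Function classes and time averages\<close>

text \<open>Real powers of nonnegative numbers with the convention \<open>0\<^sup>0 = 1\<close> (whereas \<open>0 powr 0 = 0\<close>).\<close>

definition rpow :: "real \<Rightarrow> real \<Rightarrow> real" where
  "rpow x a = (if a = 0 then 1 else x powr a)"

definition class_G :: "real \<Rightarrow> real \<Rightarrow> (real ^ 'n \<Rightarrow> real) set" where
  "class_G \<eta> L = {f \<in> borel_measurable borel. \<forall>x. \<bar>f x\<bar> \<le> L * (1 + rpow (norm x) \<eta>)}"

definition class_F :: "(real ^ 'n) measure \<Rightarrow> real \<Rightarrow> real \<Rightarrow> (real ^ 'n \<Rightarrow> real) set" where
  "class_F \<mu> \<eta> L = {(\<lambda>x. f x - (LINT y|\<mu>. f y)) | f. f \<in> class_G \<eta> L}"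

definition GG :: "(real \<Rightarrow> 'w \<Rightarrow> real ^ 'n) \<Rightarrow> real \<Rightarrow> (real ^ 'n \<Rightarrow> real) \<Rightarrow> 'w \<Rightarrow> real" where
  "GG X t f w = t powr (- 1 / 2) * (LBINT s:{0..t}. f (X s w))"

definition time_average :: "(real \<Rightarrow> 'w \<Rightarrow> real ^ 'n) \<Rightarrow> real \<Rightarrow> (real ^ 'n \<Rightarrow> real) \<Rightarrow> 'w \<Rightarrow> real" where
  "time_average X t f w = (1 / t) * (LBINT s:{0..t}. f (X s w))"

section \<open>Constants\<close>

definition pos_part :: "real \<Rightarrow> real" where
  "pos_part q = max q 0"

definition diffusion_matrix :: "(real ^ 'n \<Rightarrow> real ^ 'n ^ 'n) \<Rightarrow> real ^ 'n \<Rightarrow> real ^ 'n ^ 'n" where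
  "diffusion_matrix \<sigma> x = \<sigma> x ** transpose (\<sigma> x)"

definition lambda_plus :: "(real ^ 'n \<Rightarrow> real ^ 'n ^ 'n) \<Rightarrow> real" where
  "lambda_plus \<sigma> = (LEAST C. \<forall>x. x \<noteq> 0 \<longrightarrow>
     (diffusion_matrix \<sigma> x *v (x /\<^sub>R norm x)) \<bullet> (x /\<^sub>R norm x) \<le> C)"

definition iota' :: "real \<Rightarrow> real \<Rightarrow> real \<Rightarrow> real \<Rightarrow> real" where
  "iota' q r lam \<iota> = \<iota> powr ((1 + pos_part q) / (1 - pos_part q)) * (1 + pos_part q)
     * (r - lam * \<iota> * (1 - pos_part q) / 2)"

definition c_const :: "real \<Rightarrow> real \<Rightarrow> real" where
  "c_const q \<iota>'' = 1 / 2
     * ((1 + pos_part q) / (1 - pos_part q)) powr (1 / (1 - pos_part q))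
     * ((1 - pos_part q) * \<iota>'' / (1 + pos_part q)) powr ((1 + pos_part q) / (2 * (1 - pos_part q)))"

definition u_min :: "real \<Rightarrow> real \<Rightarrow> real" where
  "u_min q \<cc> = \<cc> * (1 + pos_part q) * (1 - pos_part q) powr (- (1 - pos_part q) / 2)"

text \<open>The next two predicates state the known deviation inequality for bounded \<open>f\<close> and the known
  \<open>L\<^sup>p\<close>-bound under the stationary law; the constants \<open>\<cc>\<close> and \<open>\<WW>\<close> are uniform in the size \<open>L\<close> of
  the function class.\<close>

definition tail_constant ::
  "(real ^ 'n \<Rightarrow> 'w measure) \<Rightarrow> (real \<Rightarrow> 'w \<Rightarrow> real ^ 'n) \<Rightarrow> (real ^ 'n) measure \<Rightarrow>
   real \<Rightarrow> real \<Rightarrow> real \<Rightarrow> bool" where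
  "tail_constant P X \<mu> q \<iota>'' \<cc> \<longleftrightarrow> 0 < \<cc> \<and>
     (\<forall>L>0. \<forall>f\<in>class_F \<mu> 0 L. \<forall>u>0. \<forall>t>0.
        u_min q \<cc> \<le> u \<and> u < (c_const q \<iota>'' * real_of_int \<lfloor>t\<rfloor> / sqrt t) powr (1 - pos_part q) \<longrightarrow>
        measure (law_from P \<mu>) {w \<in> space (law_from P \<mu>).
            \<bar>GG X t f w\<bar> > 2 * L * (u powr (1 / (1 - pos_part q)) / c_const q \<iota>'' + t powr (- 1 / 2))}
          \<le> 2 * exp (- u))"

definition moment_exponent :: "real \<Rightarrow> real \<Rightarrow> real \<Rightarrow> real" where
  "moment_exponent \<eta> q q' = 1 / 2 + (\<eta> + q' + q + 1) / (1 - pos_part q)"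

definition moment_constant ::
  "(real ^ 'n \<Rightarrow> 'w measure) \<Rightarrow> (real \<Rightarrow> 'w \<Rightarrow> real ^ 'n) \<Rightarrow> (real ^ 'n) measure \<Rightarrow>
   real \<Rightarrow> real \<Rightarrow> real \<Rightarrow> real \<Rightarrow> bool" where
  "moment_constant P X \<mu> \<eta> q q' \<WW> \<longleftrightarrow>
     (\<forall>L>0. \<forall>f\<in>class_F \<mu> \<eta> L. \<forall>p\<ge>2. \<forall>t>0.
        integrable (law_from P \<mu>) (\<lambda>w. \<bar>GG X t f w\<bar> powr p) \<and>
        (LINT w|law_from P \<mu>. \<bar>GG X t f w\<bar> powr p) powr (1 / p)
          \<le> L * \<WW> * p powr moment_exponent \<eta> q q')"

definition rate_exponent :: "real \<Rightarrow> real \<Rightarrow> real \<Rightarrow> real" where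
  "rate_exponent \<eta> q q' = (if \<eta> = 0 then 1 / (1 - pos_part q) else moment_exponent \<eta> q q')"

definition sample_length ::
  "real \<Rightarrow> real \<Rightarrow> real \<Rightarrow> real \<Rightarrow> real \<Rightarrow> real \<Rightarrow> real \<Rightarrow> real \<Rightarrow> real" where
  "sample_length \<eta> q q' \<iota>'' L \<WW> \<epsilon> \<delta> =
     (if \<eta> = 0
      then ((ln (2 / \<delta>) powr (1 / (1 - pos_part q)) / c_const q \<iota>'' + 1) / min 1 (\<epsilon> / (2 * L)))\<^sup>2
      else (exp 1 * L * \<WW> * ln (1 / \<delta>) powr moment_exponent \<eta> q q' / \<epsilon>)\<^sup>2)"

end

theory Submission
  imports Defs "HOL-Real_Asymp.Real_Asymp"
begin

text \<open>
  Write \<open>m = \<mu>(f)\<close>. For \<open>t > 0\<close> the error of the time average over \<open>[0,t]\<close> is \<open>t\<^sup>-\<^sup>1\<^sup>/\<^sup>2\<close> times the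
  normalized functional \<open>G\<^sub>t = GG X t (f - m)\<close> (lemma \<open>GG_centred\<close>), so all three claims are
  statements about the tails of \<open>G\<^sub>t\<close> under the stationary law. If \<open>\<eta> = 0\<close> these tails are the given
  deviation inequality; if \<open>\<eta> > 0\<close> they come from the moment bound by Markov's inequality with
  the moment order \<open>p = u\<close> as large as the deviation level (\<open>moment_constant_tail\<close>).

  For the sample length, take \<open>u = ln (2/\<delta>)\<close>, respectively \<open>u = ln (1/\<delta>)\<close>, so that the
  tail bound equals \<open>\<delta>\<close>. The function \<open>sample_length\<close> is chosen so that the corresponding
  threshold for \<open>G\<^sub>t\<close> is at most \<open>\<epsilon> \<surd>t\<close>, and, for \<open>\<eta> = 0\<close>, so that \<open>u\<close> lies in the range in
  which the deviation inequality is valid.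

  For the almost sure rates, take \<open>u = 2 ln t\<close>: then \<open>\<bar>G\<^sub>t\<bar>\<close> exceeds a multiple of
  \<open>(ln t)\<^sup>\<kappa>\<close> with probability at most \<open>2 t\<^sup>-\<^sup>2\<close>, where \<open>\<kappa>\<close> is the rate exponent, or
  \<open>1 / (1 - pos_part q)\<close> for bounded \<open>f\<close>
  (\<open>tail_constant_log_tail\<close>, \<open>moment_constant_log_tail\<close>). A sequence whose increments are bounded
  away from zero grows at least linearly, so these probabilities are summable along it, and the
  Borel--Cantelli lemma gives \<open>\<bar>G\<^sub>t\<bar> = O((ln t)\<^sup>\<kappa>)\<close> almost surely; any larger power of the logarithm
  then wins (\<open>AE_log_rate\<close>). For bounded \<open>f\<close> the integral changes by at most a constant between
  consecutive integers, so convergence along the integers extends to continuous time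
  (\<open>normalized_integral_interpolation\<close>).
\<close>

section \<open>Additive functionals along a continuous path\<close>

text \<open>A continuous path stays in a ball during \<open>[0,t]\<close>, and functions of polynomial growth are bounded
  on balls. Hence time integrals along paths are genuine integrals, on which linearity may be used.\<close>

lemma class_G_set_integrable_path:
  fixes \<gamma> :: "real \<Rightarrow> real ^ 'n"
  assumes f: "f \<in> class_G \<eta> L" and \<eta>: "0 \<le> \<eta>" and L: "0 < L"
    and \<gamma>: "continuous_on {0..} \<gamma>"
  shows "set_integrable lborel {0..t} (\<lambda>s. f (\<gamma> s))"
proof -
  have cont: "continuous_on {0..t} \<gamma>"
    using \<gamma> by (rule continuous_on_subset) auto
  have "bounded (\<gamma> ` {0..t})"
    using cont by (intro compact_imp_bounded compact_continuous_image) auto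
  then obtain R where R: "\<And>s. s \<in> {0..t} \<Longrightarrow> norm (\<gamma> s) \<le> R"
    unfolding bounded_iff by blast
  have bound: "\<bar>f (\<gamma> s)\<bar> \<le> L * (1 + (1 + R powr \<eta>))" if "s \<in> {0..t}" for s
  proof -
    have "rpow (norm (\<gamma> s)) \<eta> \<le> 1 + R powr \<eta>"
      using powr_mono2[OF \<eta> norm_ge_zero R[OF that]] by (simp add: rpow_def)
    moreover have "\<bar>f (\<gamma> s)\<bar> \<le> L * (1 + rpow (norm (\<gamma> s)) \<eta>)"
      using f by (simp add: class_G_def)
    ultimately show ?thesis
      using L mult_left_mono[of "1 + rpow (norm (\<gamma> s)) \<eta>" "1 + (1 + R powr \<eta>)" L] by linarith
  qed
  have [measurable]: "f \<in> borel_measurable borel"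
    using f by (simp add: class_G_def)
  have [measurable]: "(\<lambda>s. indicator {0..t} s *\<^sub>R \<gamma> s) \<in> borel_measurable borel"
    using borel_measurable_continuous_on_indicator[OF _ cont] by simp
  \<comment> \<open>The path need not be measurable at negative times, so it is cut off inside \<open>f\<close> as well.\<close>
  have "(\<lambda>s. indicator {0..t} s *\<^sub>R f (indicator {0..t} s *\<^sub>R \<gamma> s)) \<in> borel_measurable lborel"
    by measurable
  also have "(\<lambda>s. indicator {0..t} s *\<^sub>R f (indicator {0..t} s *\<^sub>R \<gamma> s))
      = (\<lambda>s. indicator {0..t} s *\<^sub>R f (\<gamma> s))"
    by (auto simp: indicator_def)
  finally have "set_borel_measurable lborel {0..t} (\<lambda>s. f (\<gamma> s))"
    by (simp add: set_borel_measurable_def)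
  moreover have "AE s in lborel. s \<in> {0..t} \<longrightarrow> norm (f (\<gamma> s)) \<le> norm (L * (1 + (1 + R powr \<eta>)))"
    using bound by (intro AE_I2 impI) (unfold real_norm_def, rule order_trans[OF _ abs_ge_self])
  moreover have "set_integrable lborel {0..t} (\<lambda>_. L * (1 + (1 + R powr \<eta>)))"
    unfolding set_integrable_def by (auto simp: emeasure_lborel_Icc_eq)
  ultimately show ?thesis
    by (rule set_integrable_bound[rotated])
qed

lemma GG_centred:
  assumes int: "set_integrable lborel {0..t} (\<lambda>s. f (X s w))" and t: "0 < t"
  shows "GG X t (\<lambda>x. f x - m) w = sqrt t * (time_average X t f w - m)"
proof -
  have c: "set_integrable lborel {0..t} (\<lambda>_. m)"
    by (auto simp: set_integrable_def emeasure_lborel_Icc_eq)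
  have "(LBINT s:{0..t}. f (X s w) - m) = (LBINT s:{0..t}. f (X s w)) - t * m"
    using t by (simp add: set_integral_diff(2)[OF int c]) (simp add: set_lebesgue_integral_def)
  moreover have "t powr (- 1 / 2) = sqrt t / t"
    using t powr_minus_divide[of t "1 / 2"] by (simp add: powr_half_sqrt real_div_sqrt frac_eq_eq)
  moreover have "sqrt t / t * (I - t * m) = sqrt t * (1 / t * I - m)" for I
    using t by (simp add: right_diff_distrib)
  ultimately show ?thesis
    unfolding GG_def time_average_def by simp
qed

text \<open>With \<open>n = \<lfloor>t\<rfloor>\<close>, the integrals over \<open>[0,t]\<close> and \<open>[0,n]\<close> differ by at most \<open>B\<close>. Since
  \<open>t\<^sup>-\<^sup>1\<^sup>/\<^sup>2\<close> and \<open>(ln t)\<^sup>-\<^sup>\<rho>\<close> are decreasing, the expression at \<open>t\<close> is at most the one at \<open>n\<close> plus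
  \<open>B t\<^sup>-\<^sup>1\<^sup>/\<^sup>2 (ln t)\<^sup>-\<^sup>\<rho>\<close>, which vanishes in the limit.\<close>

lemma normalized_integral_interpolation:
  fixes h :: "real \<Rightarrow> real"
  assumes int: "\<And>t. set_integrable lborel {0..t} h"
    and B: "\<And>s. 0 \<le> s \<Longrightarrow> \<bar>h s\<bar> \<le> B" and \<rho>: "0 < \<rho>"
    and lim: "(\<lambda>n. ln (real n) powr (- \<rho>) * \<bar>real n powr (- 1 / 2) * (LBINT s:{0..real n}. h s)\<bar>)
                \<longlonglongrightarrow> 0"
  shows "((\<lambda>t. ln t powr (- \<rho>) * \<bar>t powr (- 1 / 2) * (LBINT s:{0..t}. h s)\<bar>) \<longlongrightarrow> 0) at_top"
proof -
  define D where "D n = ln (real n) powr (- \<rho>)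
      * \<bar>real n powr (- 1 / 2) * (LBINT s:{0..real n}. h s)\<bar>" for n
  have B0: "0 \<le> B" using B[of 0] by simp
  have floor: "filterlim (\<lambda>t::real. nat \<lfloor>t\<rfloor>) sequentially at_top"
    by (intro filterlim_compose[OF filterlim_nat_sequentially] filterlim_floor_sequentially)
  have le: "\<bar>ln t powr (- \<rho>) * \<bar>t powr (- 1 / 2) * (LBINT s:{0..t}. h s)\<bar>\<bar>
      \<le> D (nat \<lfloor>t\<rfloor>) + ln t powr (- \<rho>) * (t powr (- 1 / 2) * B)" if t: "2 \<le> t" for t
  proof -
    define n where "n = nat \<lfloor>t\<rfloor>"
    have n: "2 \<le> real n" "real n \<le> t" "t \<le> real n + 1"
      using t le_nat_floor[of 2 t] unfolding n_def by (simp, linarith, linarith)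
    have un: "{0..t} = {0..real n} \<union> {real n<..t}" using n by auto
    have int': "set_integrable lborel {real n<..t} h"
      by (rule set_integrable_subset[OF int[of t]]) (use n in auto)
    have "\<bar>LBINT s:{real n<..t}. h s\<bar> \<le> (LBINT s:{real n<..t}. \<bar>h s\<bar>)"
      using set_integral_norm_bound[OF int'] by simp
    also have "\<dots> \<le> (LBINT s:{real n<..t}. B)"
      using int' n B by (intro set_integral_mono set_integrable_abs) (auto simp: set_integrable_def)
    also have "\<dots> = B * (t - real n)"
      using n by (simp add: set_lebesgue_integral_def)
    also have "\<dots> \<le> B" using B0 n mult_left_mono[of "t - real n" 1 B] by simp
    finally have rest: "\<bar>LBINT s:{real n<..t}. h s\<bar> \<le> B" .
    have "(LBINT s:{0..t}. h s) = (LBINT s:{0..real n}. h s) + (LBINT s:{real n<..t}. h s)"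
      unfolding un by (rule set_integral_Un[OF _ int int']) auto
    then have "\<bar>LBINT s:{0..t}. h s\<bar> \<le> \<bar>LBINT s:{0..real n}. h s\<bar> + B"
      using rest by linarith
    then have "t powr (- 1 / 2) * \<bar>LBINT s:{0..t}. h s\<bar>
        \<le> t powr (- 1 / 2) * \<bar>LBINT s:{0..real n}. h s\<bar> + t powr (- 1 / 2) * B"
      by (metis distrib_left mult_left_mono powr_ge_zero)
    also have "t powr (- 1 / 2) * \<bar>LBINT s:{0..real n}. h s\<bar>
        \<le> real n powr (- 1 / 2) * \<bar>LBINT s:{0..real n}. h s\<bar>"
      using n by (intro mult_right_mono powr_mono2') auto
    finally have "ln t powr (- \<rho>) * (t powr (- 1 / 2) * \<bar>LBINT s:{0..t}. h s\<bar>)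
        \<le> ln t powr (- \<rho>) * (real n powr (- 1 / 2) * \<bar>LBINT s:{0..real n}. h s\<bar>)
          + ln t powr (- \<rho>) * (t powr (- 1 / 2) * B)"
      by (metis (no_types, lifting) add_right_mono distrib_left mult_left_mono powr_ge_zero)
    moreover have "ln t powr (- \<rho>) * (real n powr (- 1 / 2) * \<bar>LBINT s:{0..real n}. h s\<bar>)
        \<le> ln (real n) powr (- \<rho>) * (real n powr (- 1 / 2) * \<bar>LBINT s:{0..real n}. h s\<bar>)"
      using n \<rho> by (intro mult_right_mono powr_mono2') auto
    ultimately show ?thesis
      by (simp add: D_def abs_mult n_def[symmetric])
  qed
  have "((\<lambda>t. D (nat \<lfloor>t\<rfloor>) + ln t powr (- \<rho>) * (t powr (- 1 / 2) * B)) \<longlongrightarrow> 0 + 0) at_top"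
  proof (rule tendsto_add)
    show "((\<lambda>t::real. D (nat \<lfloor>t\<rfloor>)) \<longlongrightarrow> 0) at_top"
      using filterlim_compose[OF lim floor] by (simp add: D_def)
    show "((\<lambda>t. ln t powr (- \<rho>) * (t powr (- 1 / 2) * B)) \<longlongrightarrow> 0) at_top"
      using \<rho> by real_asymp
  qed
  then have "((\<lambda>t. D (nat \<lfloor>t\<rfloor>) + ln t powr (- \<rho>) * (t powr (- 1 / 2) * B)) \<longlongrightarrow> 0) at_top"
    by simp
  moreover have "eventually (\<lambda>t. norm (ln t powr (- \<rho>) * \<bar>t powr (- 1 / 2) * (LBINT s:{0..t}. h s)\<bar>)
      \<le> D (nat \<lfloor>t\<rfloor>) + ln t powr (- \<rho>) * (t powr (- 1 / 2) * B)) at_top"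
    using eventually_ge_at_top[of 2] by (rule eventually_mono) (unfold real_norm_def, rule le)
  ultimately show ?thesis by (rule Lim_null_comparison[rotated])
qed

section \<open>From tail bounds to almost sure rates\<close>

text \<open>Markov's inequality for \<open>Y\<^sup>p\<close> at the level \<open>(e K)\<^sup>p\<close>: the factor \<open>e\<close> in the threshold produces
  \<open>e\<^sup>-\<^sup>p\<close>. If \<open>K = 0\<close>, Markov's inequality says nothing, but then \<open>Y\<close> vanishes almost surely.\<close>

lemma (in prob_space) tail_of_moment_bound:
  fixes Y :: "'a \<Rightarrow> real"
  assumes Y [measurable]: "Y \<in> borel_measurable M" and Y0: "\<And>w. 0 \<le> Y w" and p: "0 < p"
    and int: "integrable M (\<lambda>w. Y w powr p)"
    and K: "(LINT w|M. Y w powr p) powr (1 / p) \<le> K"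
  shows "prob {w \<in> space M. exp 1 * K < Y w} \<le> exp (- p)"
proof -
  have I0: "0 \<le> (LINT w|M. Y w powr p)" by simp
  have K0: "0 \<le> K" using K powr_ge_zero order_trans by blast
  have I: "(LINT w|M. Y w powr p) \<le> K powr p"
    using powr_mono2[OF _ powr_ge_zero K, of p] p I0 by (simp add: powr_powr)
  show ?thesis
  proof (cases "K = 0")
    case True
    then have "(LINT w|M. Y w powr p) = 0"
      using I I0 by simp
    then have "AE w in M. Y w powr p = 0"
      using integral_nonneg_eq_0_iff_AE[OF int] by simp
    then have "AE w in M. \<not> exp 1 * K < Y w"
      by eventually_elim (use True in auto)
    then have "prob {w \<in> space M. exp 1 * K < Y w} = 0"
      by (subst prob_eq_0) auto
    then show ?thesis by simp
  next
    case False
    then have Kpos: "0 < K" using K0 by simp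
    then have c: "0 < (exp 1 * K) powr p" by simp
    have "prob {w \<in> space M. exp 1 * K < Y w}
        \<le> prob {w \<in> space M. (exp 1 * K) powr p \<le> Y w powr p}"
      using Kpos p by (intro finite_measure_mono) (auto intro!: powr_mono2)
    also have "\<dots> \<le> (LINT w|M. Y w powr p) / (exp 1 * K) powr p"
      by (rule integral_Markov_inequality_measure[OF int _ _ c, of "space M"]) auto
    also have "\<dots> \<le> K powr p / (exp 1 * K) powr p"
      using I c by (intro divide_right_mono) auto
    also have "\<dots> = exp (- p)"
      using Kpos by (simp add: powr_def ln_mult exp_diff[symmetric] algebra_simps)
    finally show ?thesis .
  qed
qed

text \<open>Converts a deviation bound for \<open>Y\<close> into a confidence level for the rescaled quantity \<open>Z\<close>; below,
  \<open>Y\<close> is \<open>\<bar>G\<^sub>t\<bar>\<close>, \<open>Z\<close> is the error of the time average and \<open>c = \<surd>t\<close>.\<close>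

lemma (in prob_space) confidence_of_deviation:
  fixes Y Z :: "'a \<Rightarrow> real"
  assumes Y [measurable]: "Y \<in> borel_measurable M"
    and Z: "\<And>w. w \<in> space M \<Longrightarrow> Y w = c * Z w" and c: "0 < c"
    and tail: "prob {w \<in> space M. a < Y w} \<le> \<delta>" and a: "a \<le> c * \<epsilon>"
  shows "1 - \<delta> \<le> prob {w \<in> space M. Z w \<le> \<epsilon>}"
proof -
  have "1 - prob {w \<in> space M. a < Y w} = prob {w \<in> space M. Y w \<le> a}"
    by (subst prob_compl[symmetric]) (auto intro!: arg_cong[where f = prob])
  also have "\<dots> \<le> prob {w \<in> space M. Y w \<le> c * \<epsilon>}"
    using a by (intro finite_measure_mono) auto
  also have "{w \<in> space M. Y w \<le> c * \<epsilon>} = {w \<in> space M. Z w \<le> \<epsilon>}"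
    using Z c by auto
  finally show ?thesis using tail by simp
qed

text \<open>The tail probabilities are at most \<open>2 / (d n)\<^sup>2\<close> and hence summable. By Borel--Cantelli,
  \<open>Y n \<le> C (ln t\<^sub>n)\<^sup>\<kappa>\<close> for all large \<open>n\<close>, almost surely, and \<open>(ln t\<^sub>n)\<^sup>\<kappa>\<^sup>-\<^sup>\<rho>\<close> tends to \<open>0\<close>.\<close>

lemma (in prob_space) AE_log_rate:
  fixes Y :: "nat \<Rightarrow> 'a \<Rightarrow> real" and t :: "nat \<Rightarrow> real"
  assumes Y [measurable]: "\<And>n. Y n \<in> borel_measurable M" and Y0: "\<And>n w. 0 \<le> Y n w"
    and d: "0 < d" and t: "\<And>n. d * real n \<le> t n" and \<rho>: "\<kappa> < \<rho>"
    and tail: "eventually (\<lambda>n. prob {w \<in> space M. C * ln (t n) powr \<kappa> < Y n w} \<le> 2 * t n powr (- 2))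
                 sequentially"
  shows "AE w in M. (\<lambda>n. ln (t n) powr (- \<rho>) * Y n w) \<longlonglongrightarrow> 0"
proof -
  define A where "A n = {w \<in> space M. C * ln (t n) powr \<kappa> < Y n w}" for n
  have [measurable]: "A n \<in> sets M" for n unfolding A_def by measurable
  have "filterlim (\<lambda>n. d * real n) at_top sequentially"
    using d by real_asymp
  then have t_top: "filterlim t at_top sequentially"
    by (rule filterlim_at_top_mono) (simp add: t)
  have dom: "summable (\<lambda>n. 2 / d\<^sup>2 * (1 / real n ^ 2))"
    by (intro summable_mult inverse_power_summable[of 2, simplified inverse_eq_divide]) simp
  have "eventually (\<lambda>n. norm (prob (A n)) \<le> 2 / d\<^sup>2 * (1 / real n ^ 2)) sequentially"
    using tail eventually_gt_at_top[of 0]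
  proof eventually_elim
    case (elim n)
    have dn: "0 < d * real n" using d elim by simp
    have "prob (A n) \<le> 2 * t n powr (- 2)" using elim by (simp add: A_def)
    also have "\<dots> \<le> 2 * (d * real n) powr (- 2)"
      using dn t[of n] by (intro mult_left_mono powr_mono2') auto
    also have "\<dots> = 2 / d\<^sup>2 * (1 / real n ^ 2)"
      using dn by (simp add: powr_minus powr_numeral field_simps)
    finally show ?case by simp
  qed
  then have "summable (\<lambda>n. prob (A n))"
    using dom by (rule summable_comparison_test_ev)
  then have "AE w in M. eventually (\<lambda>n. w \<in> space M - A n) sequentially"
    by (intro borel_cantelli_AE1) (auto simp: emeasure_eq_measure)
  moreover have "(\<lambda>n. ln (t n) powr (- \<rho>) * Y n w) \<longlonglongrightarrow> 0"
    if ev: "eventually (\<lambda>n. w \<in> space M - A n) sequentially" for w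
  proof (rule Lim_null_comparison)
    show "eventually (\<lambda>n. norm (ln (t n) powr (- \<rho>) * Y n w) \<le> C * ln (t n) powr (\<kappa> - \<rho>)) sequentially"
      using ev
    proof eventually_elim
      case (elim n)
      then have "Y n w \<le> C * ln (t n) powr \<kappa>" by (auto simp: A_def)
      then have "ln (t n) powr (- \<rho>) * Y n w \<le> ln (t n) powr (- \<rho>) * (C * ln (t n) powr \<kappa>)"
        by (intro mult_left_mono) auto
      also have "\<dots> = C * ln (t n) powr (\<kappa> - \<rho>)"
        by (simp add: powr_add[symmetric])
      finally show ?case by (simp add: Y0)
    qed
    have "((\<lambda>x. C * ln x powr (\<kappa> - \<rho>)) \<longlongrightarrow> 0) at_top"
      using \<rho> by real_asymp
    then show "(\<lambda>n. C * ln (t n) powr (\<kappa> - \<rho>)) \<longlonglongrightarrow> 0"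
      using t_top by (rule filterlim_compose)
  qed
  ultimately show ?thesis by (rule eventually_mono)
qed

text \<open>Monotonicity makes the set of increments bounded below, so that their infimum
  over the reals is a lower bound of each of them.\<close>

lemma incseq_linear_growth:
  fixes t :: "nat \<Rightarrow> real"
  assumes inc: "incseq t" and t0: "0 \<le> t 0"
  shows "(INF n. t (Suc n) - t n) * real n \<le> t n"
proof (induction n)
  case 0
  then show ?case using t0 by simp
next
  case (Suc n)
  have "bdd_below (range (\<lambda>n. t (Suc n) - t n))"
    using inc by (intro bdd_belowI[of _ 0]) (auto simp: incseq_Suc_iff)
  then have "(INF n. t (Suc n) - t n) \<le> t (Suc n) - t n"
    by (rule cINF_lower) simp
  with Suc show ?case by (simp add: algebra_simps)
qed

section \<open>Tail bounds for the stationary diffusion\<close>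

lemma moment_constantD:
  assumes "moment_constant P X \<mu> \<eta> q q' W" and "0 < L" and "f \<in> class_F \<mu> \<eta> L"
    and "2 \<le> p" and "0 < t"
  shows "integrable (law_from P \<mu>) (\<lambda>w. \<bar>GG X t f w\<bar> powr p)"
    and "(LINT w|law_from P \<mu>. \<bar>GG X t f w\<bar> powr p) powr (1 / p)
           \<le> L * W * p powr moment_exponent \<eta> q q'"
  using assms unfolding moment_constant_def by blast+

text \<open>Joint measurability of \<open>(s, w) \<mapsto> X\<^sub>s(w)\<close> would be the usual argument; here the integrability of
  the second moment already contains the measurability of \<open>\<bar>G\<^sub>t\<bar>\<close>, as the root of its square. For
  \<open>t \<le> 0\<close> the functional is constantly \<open>0\<close>.\<close>

lemma moment_constant_measurable:
  assumes W: "moment_constant P X \<mu> \<eta> q q' W" and L: "0 < L" and f: "f \<in> class_F \<mu> \<eta> L"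
  shows "(\<lambda>w. \<bar>GG X t f w\<bar>) \<in> borel_measurable (law_from P \<mu>)"
proof (cases "0 < t")
  case True
  then have "integrable (law_from P \<mu>) (\<lambda>w. \<bar>GG X t f w\<bar> powr 2)"
    by (intro moment_constantD(1)[OF W L f]) auto
  then have "(\<lambda>w. sqrt (\<bar>GG X t f w\<bar> powr 2)) \<in> borel_measurable (law_from P \<mu>)"
    by measurable
  then show ?thesis by simp
next
  case False
  then have "GG X t f w = 0" for w
    by (cases "t = 0") (auto simp: GG_def set_lebesgue_integral_def)
  then show ?thesis by simp
qed

lemma moment_constant_tail:
  assumes M: "prob_space (law_from P \<mu>)" and W: "moment_constant P X \<mu> \<eta> q q' W"
    and L: "0 < L" and f: "f \<in> class_F \<mu> \<eta> L" and t: "0 < t" and u: "2 \<le> u"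
  shows "measure (law_from P \<mu>) {w \<in> space (law_from P \<mu>).
           exp 1 * (L * W * u powr moment_exponent \<eta> q q') < \<bar>GG X t f w\<bar>} \<le> exp (- u)"
proof -
  interpret prob_space "law_from P \<mu>" by (fact M)
  show ?thesis
    using u moment_constantD[OF W L f u t]
    by (intro tail_of_moment_bound moment_constant_measurable[OF W L f]) auto
qed

text \<open>The level is \<open>u = 2 ln t\<close>, for which \<open>e\<^sup>-\<^sup>u = t\<^sup>-\<^sup>2\<close>; it is at least \<open>2\<close> as soon as \<open>t \<ge> e\<close>. The
  factor \<open>2\<close> on the right gives the bound the same form as in the case of bounded \<open>f\<close>.\<close>

lemma moment_constant_log_tail:
  assumes M: "prob_space (law_from P \<mu>)" and W: "moment_constant P X \<mu> \<eta> q q' W"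
    and L: "0 < L" and f: "f \<in> class_F \<mu> \<eta> L"
  shows "\<exists>C. eventually (\<lambda>t. measure (law_from P \<mu>) {w \<in> space (law_from P \<mu>).
           C * ln t powr moment_exponent \<eta> q q' < \<bar>GG X t f w\<bar>} \<le> 2 * t powr (- 2)) at_top"
proof (intro exI eventually_mono[OF eventually_ge_at_top])
  let ?\<kappa> = "moment_exponent \<eta> q q'"
  fix t :: real assume t: "exp 1 \<le> t"
  then have t0: "0 < t" and ln: "1 \<le> ln t"
    using exp_gt_zero[of 1] by (linarith, simp add: ln_ge_iff less_le_trans[OF exp_gt_zero])
  have eq1: "exp (- (2 * ln t)) = t powr (- 2)" using t0 by (simp add: powr_def)
  have eq2: "exp 1 * (L * W * (2 * ln t) powr ?\<kappa>) = exp 1 * L * W * 2 powr ?\<kappa> * ln t powr ?\<kappa>"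
    using powr_mult[of 2 "ln t" ?\<kappa>] ln by simp
  have "measure (law_from P \<mu>) {w \<in> space (law_from P \<mu>).
        exp 1 * L * W * 2 powr ?\<kappa> * ln t powr ?\<kappa> < \<bar>GG X t f w\<bar>} \<le> t powr (- 2)"
    using moment_constant_tail[OF M W L f t0, of "2 * ln t"] ln unfolding eq1 eq2 by simp
  then show "measure (law_from P \<mu>) {w \<in> space (law_from P \<mu>).
        (exp 1 * L * W * 2 powr ?\<kappa>) * ln t powr ?\<kappa> < \<bar>GG X t f w\<bar>} \<le> 2 * t powr (- 2)"
    using powr_ge_zero[of t "-2"] by linarith
qed

lemma c_const_pos: "q < 1 \<Longrightarrow> 0 < \<iota>'' \<Longrightarrow> 0 < c_const q \<iota>''"
  by (auto simp: c_const_def pos_part_def intro!: mult_pos_pos)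

lemma tail_constantD:
  assumes "tail_constant P X \<mu> q \<iota>'' \<cc>" and "0 < L" and "f \<in> class_F \<mu> 0 L" and "0 < u" and "0 < t"
    and "u_min q \<cc> \<le> u" and "u < (c_const q \<iota>'' * of_int \<lfloor>t\<rfloor> / sqrt t) powr (1 - pos_part q)"
  shows "measure (law_from P \<mu>) {w \<in> space (law_from P \<mu>).
      2 * L * (u powr (1 / (1 - pos_part q)) / c_const q \<iota>'' + t powr (- 1 / 2)) < \<bar>GG X t f w\<bar>}
        \<le> 2 * exp (- u)"
  using assms unfolding tail_constant_def by blast

text \<open>Again \<open>u = 2 ln t\<close>. It eventually exceeds the lower limit \<open>u_min\<close>, and it stays below the
  upper limit, which grows like a positive power of \<open>t\<close>. The extra term \<open>t\<^sup>-\<^sup>1\<^sup>/\<^sup>2\<close> of the threshold is at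
  most \<open>1 \<le> ln t\<close> once \<open>t \<ge> e\<close> and is absorbed into the constant.\<close>

lemma tail_constant_log_tail:
  assumes M: "prob_space (law_from P \<mu>)" and c: "tail_constant P X \<mu> q \<iota>'' \<cc>"
    and q: "q < 1" and \<iota>'': "0 < \<iota>''" and L: "0 < L" and f: "f \<in> class_F \<mu> 0 L"
    and meas: "\<And>t. (\<lambda>w. \<bar>GG X t f w\<bar>) \<in> borel_measurable (law_from P \<mu>)"
  shows "\<exists>C. eventually (\<lambda>t. measure (law_from P \<mu>) {w \<in> space (law_from P \<mu>).
           C * ln t powr (1 / (1 - pos_part q)) < \<bar>GG X t f w\<bar>} \<le> 2 * t powr (- 2)) at_top"
proof -
  interpret prob_space "law_from P \<mu>" by (fact M)
  define k where "k = c_const q \<iota>''"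
  define a where "a = 1 - pos_part q"
  have k: "0 < k" using q \<iota>'' c_const_pos by (simp add: k_def)
  have a: "0 < a" using q by (simp add: a_def pos_part_def)
  define C where "C = 2 * L * (2 powr (1 / a) / k + 1)"
  have "eventually (\<lambda>t. u_min q \<cc> \<le> 2 * ln t) at_top" by real_asymp
  moreover have "eventually (\<lambda>t. 2 * ln t < (k * (t / 2) / sqrt t) powr a) at_top"
    using k a by real_asymp
  moreover have "eventually (\<lambda>t::real. exp 1 \<le> t) at_top" by (rule eventually_ge_at_top)
  ultimately have "eventually (\<lambda>t. prob {w \<in> space (law_from P \<mu>).
           C * ln t powr (1 / a) < \<bar>GG X t f w\<bar>} \<le> 2 * t powr (- 2)) at_top"
  proof eventually_elim
    case (elim t)
    have "2 \<le> t" using elim exp_ge_add_one_self[of 1] by linarith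
    then have t1: "1 \<le> t" "1 < t" by auto
    have ln: "1 \<le> ln t" using t1 elim by (simp add: ln_ge_iff)
    have "t / 2 \<le> of_int \<lfloor>t\<rfloor>"
    proof -
      have "(1 :: real) \<le> of_int \<lfloor>t\<rfloor>" using t1 by simp
      then show ?thesis by linarith
    qed
    then have "(k * (t / 2) / sqrt t) powr a \<le> (k * of_int \<lfloor>t\<rfloor> / sqrt t) powr a"
      using k a t1 by (intro powr_mono2 divide_right_mono mult_left_mono) auto
    then have "prob {w \<in> space (law_from P \<mu>).
        \<bar>GG X t f w\<bar> > 2 * L * ((2 * ln t) powr (1 / a) / k + t powr (- 1 / 2))} \<le> 2 * exp (- (2 * ln t))"
      using elim t1 ln unfolding k_def a_def by (intro tail_constantD[OF c L f]) auto
    moreover have "2 * L * ((2 * ln t) powr (1 / a) / k + t powr (- 1 / 2)) \<le> C * ln t powr (1 / a)"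
    proof -
      have "t powr (- 1 / 2) \<le> t powr 0" using t1 by (intro powr_mono) auto
      also have "\<dots> \<le> ln t powr (1 / a)" using t1 ln a by (simp add: ge_one_powr_ge_zero)
      finally have "(2 * ln t) powr (1 / a) / k + t powr (- 1 / 2) \<le> (2 powr (1 / a) / k + 1) * ln t powr (1 / a)"
        using ln by (simp add: powr_mult algebra_simps)
      from mult_left_mono[OF this, of "2 * L"] show ?thesis using L by (simp add: C_def mult.assoc)
    qed
    then have "prob {w \<in> space (law_from P \<mu>). C * ln t powr (1 / a) < \<bar>GG X t f w\<bar>}
        \<le> prob {w \<in> space (law_from P \<mu>).
            \<bar>GG X t f w\<bar> > 2 * L * ((2 * ln t) powr (1 / a) / k + t powr (- 1 / 2))}"
      using meas[of t] by (intro finite_measure_mono) auto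
    moreover have "exp (- (2 * ln t)) = t powr (- 2)" using t1 by (simp add: powr_def)
    ultimately show ?case by simp
  qed
  then show ?thesis unfolding a_def by blast
qed

section \<open>Sample length and convergence rates\<close>

theorem corollary3p7:
  fixes b :: "real ^ 'n \<Rightarrow> real ^ 'n"
    and \<sigma> :: "real ^ 'n \<Rightarrow> real ^ 'n ^ 'n"
    and N :: "'w measure" and F :: "real \<Rightarrow> 'w measure"
    and P :: "real ^ 'n \<Rightarrow> 'w measure" and X :: "real \<Rightarrow> 'w \<Rightarrow> real ^ 'n"
    and \<mu> :: "(real ^ 'n) measure"
    and q q' M\<^sub>0 \<rr> \<iota> \<iota>'' \<cc> \<WW> \<eta> L :: real
    and f :: "real ^ 'n \<Rightarrow> real"
  assumes b_lipschitz: "local_lipschitz (UNIV :: real set) UNIV (\<lambda>_. b)"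
    and q'_nonneg: "0 \<le> q'"
    and b_growth: "\<exists>C. \<forall>x. norm (b x) \<le> C * (1 + rpow (norm x) q')"
    and \<sigma>_uniformly_continuous: "uniformly_continuous_on UNIV \<sigma>"
    and \<sigma>_bounded: "bounded (range \<sigma>)"
    and \<sigma>_lipschitz: "local_lipschitz (UNIV :: real set) UNIV (\<lambda>_. \<sigma>)"
    and elliptic: "\<exists>\<kappa>>0. \<forall>x \<xi>. \<kappa> * (norm \<xi>)\<^sup>2 \<le> (diffusion_matrix \<sigma> x *v \<xi>) \<bullet> \<xi>"
    and q_range: "- 1 \<le> q" "q < 1"
    and drift_constants: "0 \<le> M\<^sub>0" "0 < \<rr>"
    and drift: "\<And>x. x \<noteq> 0 \<Longrightarrow> M\<^sub>0 \<le> norm x \<Longrightarrow>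
                  b x \<bullet> (x /\<^sub>R norm x) \<le> - \<rr> * norm x powr (- q)"
    and X: "markovian_weak_solution b \<sigma> N F P X"
    and \<mu>: "invariant_distribution P X \<mu>"
    and \<iota>: "0 < \<iota>" "\<iota> * lambda_plus \<sigma> * (1 - pos_part q) / 2 < \<rr>"
    and \<iota>'': "0 < \<iota>''" "\<iota>'' < iota' q \<rr> (lambda_plus \<sigma>) \<iota>"
    and \<cc>: "tail_constant P X \<mu> q \<iota>'' \<cc>"
    and \<WW>: "moment_constant P X \<mu> \<eta> q q' \<WW>"
    and \<eta>: "0 \<le> \<eta>" and L: "0 < L" and f: "f \<in> class_G \<eta> L"
  shows "(\<forall>\<epsilon> \<delta> t. 0 < \<epsilon> \<and> 0 < \<delta> \<and> \<delta> < 1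
            \<and> (\<eta> = 0 \<longrightarrow> \<delta> < 2 * exp (- u_min q \<cc>)) \<and> (0 < \<eta> \<longrightarrow> \<delta> < exp (- 2))
            \<and> 0 < t \<and> sample_length \<eta> q q' \<iota>'' L \<WW> \<epsilon> \<delta> \<le> t
          \<longrightarrow> 1 - \<delta> \<le> measure (law_from P \<mu>)
                {w \<in> space (law_from P \<mu>). \<bar>time_average X t f w - (LINT y|\<mu>. f y)\<bar> \<le> \<epsilon>})
       \<and> (\<forall>(t :: nat \<Rightarrow> real) \<delta>\<^sub>0. incseq t \<and> (\<forall>n. 0 \<le> t n) \<and> 0 < (INF n. t (Suc n) - t n) \<and> 0 < \<delta>\<^sub>0
          \<longrightarrow> (AE w in law_from P \<mu>.
                (\<lambda>n. sqrt (t n) * ln (t n) powr (- (rate_exponent \<eta> q q' + \<delta>\<^sub>0))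
                  * \<bar>time_average X (t n) f w - (LINT y|\<mu>. f y)\<bar>) \<longlonglongrightarrow> 0))
       \<and> (bounded (range f) \<longrightarrow> (\<forall>q\<^sub>1. pos_part q < q\<^sub>1 \<and> q\<^sub>1 < 1
          \<longrightarrow> (AE w in law_from P \<mu>.
                ((\<lambda>t. sqrt t * ln t powr (- (1 / (1 - q\<^sub>1)))
                  * \<bar>time_average X t f w - (LINT y|\<mu>. f y)\<bar>) \<longlongrightarrow> 0) at_top)))"
proof -
  define m where "m = (LINT y|\<mu>. f y)"
  define M where "M = law_from P \<mu>"
  define g where "g = (\<lambda>x. f x - m)"
  define Y where "Y = (\<lambda>t w. \<bar>GG X t g w\<bar>)"
  have \<mu>_space: "\<mu> \<in> space (prob_algebra borel)"
    using \<mu> by (simp add: invariant_distribution_def space_prob_algebra)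
  have P_meas: "P \<in> borel \<rightarrow>\<^sub>M prob_algebra N"
    using X by (simp add: markovian_weak_solution_def)
  have prob_M: "prob_space M"
    unfolding M_def law_from_def by (rule prob_space_bind'[OF \<mu>_space P_meas])
  interpret prob_space M by (fact prob_M)
  have "sets M = sets N"
    unfolding M_def law_from_def by (rule sets_bind'[OF \<mu>_space P_meas])
  then have space_M: "space M = space N" by (rule sets_eq_imp_space_eq)
  have path: "continuous_on {0..} (\<lambda>s. X s w)" if "w \<in> space M" for w
  proof -
    have "P 0 \<in> space (prob_algebra N)" using measurable_space[OF P_meas] by simp
    then have "space (P 0) = space N"
      by (auto simp: space_prob_algebra dest: sets_eq_imp_space_eq)
    moreover obtain W where "weak_solution b \<sigma> (P 0) F X W"
      using X unfolding markovian_weak_solution_def by blast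
    ultimately show ?thesis using that space_M by (simp add: weak_solution_def)
  qed
  have int: "set_integrable lborel {0..t} (\<lambda>s. f (X s w))" if "w \<in> space M" for t w
    using class_G_set_integrable_path[OF f \<eta> L path[OF that]] .
  have g: "g \<in> class_F \<mu> \<eta> L"
    using f by (auto simp: class_F_def g_def m_def)
  have Y_meas [measurable]: "Y t \<in> borel_measurable M" for t
    using moment_constant_measurable[OF \<WW> L g] by (simp add: Y_def M_def)
  have Y_avg: "Y t w = sqrt t * \<bar>time_average X t f w - m\<bar>" if "w \<in> space M" "0 < t" for t w
    using GG_centred[of t f X w, OF int[OF that(1)] that(2)] that(2) by (simp add: Y_def g_def abs_mult)

  \<comment> \<open>It suffices to find a threshold of at most \<open>\<epsilon> \<surd>t\<close> which \<open>\<bar>G\<^sub>t\<bar>\<close> exceeds with probability at most \<open>\<delta>\<close>.\<close>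
  have confidence: "1 - \<delta> \<le> prob {w \<in> space M. \<bar>time_average X t f w - m\<bar> \<le> \<epsilon>}"
    if \<epsilon>: "0 < \<epsilon>" and \<delta>: "0 < \<delta>" "\<delta> < 1"
      and \<delta>0: "\<eta> = 0 \<Longrightarrow> \<delta> < 2 * exp (- u_min q \<cc>)" and \<delta>1: "0 < \<eta> \<Longrightarrow> \<delta> < exp (- 2)"
      and t: "0 < t" and len: "sample_length \<eta> q q' \<iota>'' L \<WW> \<epsilon> \<delta> \<le> t"
    for \<epsilon> \<delta> t
  proof -
    have "\<exists>a. prob {w \<in> space M. a < Y t w} \<le> \<delta> \<and> a \<le> sqrt t * \<epsilon>"
    proof (cases "\<eta> = 0")
      case True
      define k where "k = c_const q \<iota>''"
      define r where "r = 1 - pos_part q"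
      define u where "u = ln (2 / \<delta>)"
      define v where "v = u powr (1 / r) / k"
      have k: "0 < k" using q_range \<iota>'' c_const_pos by (simp add: k_def)
      have r: "0 < r" using q_range by (simp add: r_def pos_part_def)
      have u0: "0 < u" using \<delta> by (simp add: u_def)
      have exp_u: "2 * exp (- u) = \<delta>" using \<delta> by (simp add: u_def exp_minus)
      have u_min: "u_min q \<cc> \<le> u"
        using \<delta>0[OF True] unfolding exp_u[symmetric] by simp
      have v0: "0 \<le> v" using k by (simp add: v_def)
      define s where "s = min 1 (\<epsilon> / (2 * L))"
      have s: "0 < s" "s \<le> 1" "s \<le> \<epsilon> / (2 * L)" using \<epsilon> L by (auto simp: s_def)
      have "((v + 1) / s)\<^sup>2 \<le> t"
        using len True by (simp add: sample_length_def v_def u_def r_def k_def s_def)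
      then have sqrt_t: "(v + 1) / s \<le> sqrt t" by (rule real_le_rsqrt)
      have "v + 1 \<le> (v + 1) / s" using v0 s by (simp add: le_divide_eq mult_left_le)
      with sqrt_t have sqrt_v: "v + 1 \<le> sqrt t" by linarith
      then have "1 \<le> sqrt t" using v0 by linarith
      then have t1: "1 \<le> t" by simp
      \<comment> \<open>The summand \<open>1\<close> in the sample length pays for rounding \<open>t\<close> down:
        \<open>\<lfloor>t\<rfloor> / \<surd>t > \<surd>t - 1 / \<surd>t \<ge> \<surd>t - 1 \<ge> v\<close>. This is the upper limit on \<open>u\<close>.\<close>
      have "v < of_int \<lfloor>t\<rfloor> / sqrt t"
      proof -
        have "v * sqrt t \<le> (sqrt t - 1) * sqrt t" using sqrt_v t by (intro mult_right_mono) auto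
        also have "\<dots> = t - sqrt t" using t by (simp add: algebra_simps)
        also have "\<dots> \<le> t - 1" using \<open>1 \<le> sqrt t\<close> by simp
        also have "\<dots> < of_int \<lfloor>t\<rfloor>" by linarith
        finally show ?thesis using t by (simp add: pos_less_divide_eq)
      qed
      then have "u powr (1 / r) < k * of_int \<lfloor>t\<rfloor> / sqrt t"
        using k by (simp add: v_def pos_divide_less_eq mult.commute)
      then have "(u powr (1 / r)) powr r < (k * of_int \<lfloor>t\<rfloor> / sqrt t) powr r"
        using r by (intro powr_less_mono2) auto
      then have u_max: "u < (k * of_int \<lfloor>t\<rfloor> / sqrt t) powr r"
        using u0 r by (simp add: powr_powr)
      let ?a = "2 * L * (v + t powr (- 1 / 2))"
      have "prob {w \<in> space M. ?a < Y t w} \<le> 2 * exp (- u)"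
        using g True u0 t u_min u_max unfolding v_def r_def k_def Y_def M_def
        by (intro tail_constantD[OF \<cc> L]) auto
      moreover have "?a \<le> sqrt t * \<epsilon>"
      proof -
        have "t powr (- 1 / 2) \<le> t powr 0" using t1 by (intro powr_mono) auto
        then have "v + t powr (- 1 / 2) \<le> v + 1" using t by simp
        also have "\<dots> \<le> sqrt t * s" using sqrt_t s by (simp add: pos_divide_le_eq)
        also have "\<dots> \<le> sqrt t * (\<epsilon> / (2 * L))" using s t by (intro mult_left_mono) auto
        finally show ?thesis using L by (simp add: field_simps)
      qed
      ultimately show ?thesis unfolding exp_u by blast
    next
      case False
      then have \<eta>0: "0 < \<eta>" using \<eta> by simp
      define u where "u = ln (1 / \<delta>)"
      have exp_u: "exp (- u) = \<delta>" using \<delta> by (simp add: u_def ln_div)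
      have u2: "2 \<le> u" using \<delta>1[OF \<eta>0] unfolding exp_u[symmetric] by simp
      let ?a = "exp 1 * (L * \<WW> * u powr moment_exponent \<eta> q q')"
      have "prob {w \<in> space M. ?a < Y t w} \<le> exp (- u)"
        using moment_constant_tail[OF prob_M[unfolded M_def] \<WW> L g t u2] by (simp add: M_def Y_def)
      moreover have "(?a / \<epsilon>)\<^sup>2 \<le> t"
        using len False by (simp add: sample_length_def u_def mult.assoc)
      then have "?a / \<epsilon> \<le> sqrt t" by (rule real_le_rsqrt)
      then have "?a \<le> sqrt t * \<epsilon>" using \<epsilon> by (simp add: pos_divide_le_eq)
      ultimately show ?thesis unfolding exp_u by blast
    qed
    then obtain a where "prob {w \<in> space M. a < Y t w} \<le> \<delta>" "a \<le> sqrt t * \<epsilon>"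
      by blast
    then show ?thesis
      using t by (intro confidence_of_deviation[OF Y_meas Y_avg]) auto
  qed

  have sequence: "AE w in M. (\<lambda>n. sqrt (t n) * ln (t n) powr (- (rate_exponent \<eta> q q' + \<delta>\<^sub>0))
                  * \<bar>time_average X (t n) f w - m\<bar>) \<longlonglongrightarrow> 0"
    if inc: "incseq t" and nonneg: "\<forall>n. 0 \<le> t n" and gap: "0 < (INF n. t (Suc n) - t n)"
      and \<delta>\<^sub>0: "0 < \<delta>\<^sub>0" for t :: "nat \<Rightarrow> real" and \<delta>\<^sub>0
  proof -
    define d where "d = (INF n. t (Suc n) - t n)"
    have d: "0 < d" and growth: "d * real n \<le> t n" for n
      using gap incseq_linear_growth[OF inc] nonneg by (auto simp: d_def)
    have "filterlim (\<lambda>n. d * real n) at_top sequentially"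
      using d by real_asymp
    then have t_top: "filterlim t at_top sequentially"
      by (rule filterlim_at_top_mono) (simp add: growth)
    have "\<exists>C. eventually (\<lambda>t. prob {w \<in> space M. C * ln t powr rate_exponent \<eta> q q' < Y t w}
            \<le> 2 * t powr (- 2)) at_top"
    proof (cases "\<eta> = 0")
      case True
      then show ?thesis
        using tail_constant_log_tail[OF prob_M[unfolded M_def] \<cc> q_range(2) \<iota>''(1) L, of g] g Y_meas
        by (simp add: rate_exponent_def M_def Y_def)
    next
      case False
      then show ?thesis
        using moment_constant_log_tail[OF prob_M[unfolded M_def] \<WW> L g]
        by (simp add: rate_exponent_def M_def Y_def)
    qed
    then obtain C where "eventually (\<lambda>t. prob {w \<in> space M. C * ln t powr rate_exponent \<eta> q q' < Y t w}
            \<le> 2 * t powr (- 2)) at_top" by blast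
    from filterlim_iff[THEN iffD1, OF t_top, rule_format, OF this]
    have "AE w in M. (\<lambda>n. ln (t n) powr (- (rate_exponent \<eta> q q' + \<delta>\<^sub>0)) * Y (t n) w) \<longlonglongrightarrow> 0"
      using \<delta>\<^sub>0 by (intro AE_log_rate[OF Y_meas _ d growth]) (auto simp: Y_def)
    then show ?thesis
      using AE_space
    proof eventually_elim
      case (elim w)
      have "eventually (\<lambda>n. 0 < t n) sequentially"
        using t_top by (simp add: filterlim_at_top_dense)
      then have "eventually (\<lambda>n. ln (t n) powr (- (rate_exponent \<eta> q q' + \<delta>\<^sub>0)) * Y (t n) w
          = sqrt (t n) * ln (t n) powr (- (rate_exponent \<eta> q q' + \<delta>\<^sub>0))
              * \<bar>time_average X (t n) f w - m\<bar>) sequentially"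
        by eventually_elim (simp add: Y_avg[OF elim(2)])
      then show ?case using elim(1) by (rule Lim_transform_eventually[rotated])
    qed
  qed

  have continuous_time: "AE w in M. ((\<lambda>t. sqrt t * ln t powr (- (1 / (1 - q\<^sub>1)))
                  * \<bar>time_average X t f w - m\<bar>) \<longlongrightarrow> 0) at_top"
    if bdd: "bounded (range f)" and q\<^sub>1: "pos_part q < q\<^sub>1" "q\<^sub>1 < 1" for q\<^sub>1
  proof -
    obtain B where B: "\<And>x. \<bar>f x\<bar> \<le> B"
      using bdd by (auto simp: bounded_iff)
    \<comment> \<open>A bounded function lies in a class with \<open>\<eta> = 0\<close> whatever its given \<open>\<eta>\<close>, so the deviation
      inequality applies with \<open>\<bar>B\<bar> + 1\<close> in place of \<open>L\<close>.\<close>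
    have L': "0 < \<bar>B\<bar> + 1" by simp
    have "\<bar>f x\<bar> \<le> (\<bar>B\<bar> + 1) * (1 + rpow (norm x) 0)" for x
      using B[of x] by (simp add: rpow_def)
    then have "f \<in> class_G 0 (\<bar>B\<bar> + 1)"
      using f by (simp add: class_G_def)
    then have g': "g \<in> class_F \<mu> 0 (\<bar>B\<bar> + 1)"
      by (auto simp: class_F_def g_def m_def)
    obtain C where C: "eventually (\<lambda>t. prob {w \<in> space M. C * ln t powr (1 / (1 - pos_part q)) < Y t w}
            \<le> 2 * t powr (- 2)) at_top"
      using tail_constant_log_tail[OF prob_M[unfolded M_def] \<cc> q_range(2) \<iota>''(1) L' g'] Y_meas
      by (auto simp: M_def Y_def)
    have \<rho>: "1 / (1 - pos_part q) < 1 / (1 - q\<^sub>1)"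
      using q\<^sub>1 by (intro divide_strict_left_mono) auto
    have "AE w in M. (\<lambda>n. ln (real n) powr (- (1 / (1 - q\<^sub>1))) * Y (real n) w) \<longlonglongrightarrow> 0"
      using filterlim_iff[THEN iffD1, OF filterlim_real_sequentially, rule_format, OF C]
      by (intro AE_log_rate[where d = 1, OF Y_meas _ _ _ \<rho>]) (auto simp: Y_def)
    then show ?thesis
      using AE_space
    proof eventually_elim
      case (elim w)
      have "set_integrable lborel {0..t} (\<lambda>s. g (X s w))" for t
        unfolding g_def using int[OF elim(2)]
        by (intro set_integral_diff) (auto simp: set_integrable_def emeasure_lborel_Icc_eq)
      moreover have "\<bar>g (X s w)\<bar> \<le> B + \<bar>m\<bar>" for s
        using B[of "X s w"] by (simp add: g_def)
      ultimately have "((\<lambda>t. ln t powr (- (1 / (1 - q\<^sub>1))) * Y t w) \<longlongrightarrow> 0) at_top"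
        using elim(1) q\<^sub>1 unfolding Y_def GG_def
        by (intro normalized_integral_interpolation) auto
      moreover have "eventually (\<lambda>t. ln t powr (- (1 / (1 - q\<^sub>1))) * Y t w
          = sqrt t * ln t powr (- (1 / (1 - q\<^sub>1))) * \<bar>time_average X t f w - m\<bar>) at_top"
        using eventually_gt_at_top[of 0] by eventually_elim (simp add: Y_avg[OF elim(2)])
      ultimately show ?case by (rule Lim_transform_eventually)
    qed
  qed
  show ?thesis
    unfolding M_def[symmetric] m_def[symmetric]
    by (intro conjI allI impI; (elim conjE)?; intro confidence sequence continuous_time) simp_all
qed

end
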